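(* Let $q$ be a prime power and let $k, s$ be fixed positive integers. Let $\mathcal{V}_1, \dots, \mathcal{V}_{s+1}$ be families of $k$-dimensional subspaces of $\mathbb{F}_q^n$ such that there are no pairwise disjoint $V_1, \dots, V_{s+1}$ with $V_i \in \mathcal{V}_i$ for every $i = 1, \dots, s+1$. Then for $n$ sufficiently large, \[\min_{i \in [s+1]} |\mathcal{V}_i| \leq \genfrac{[}{]}{0pt}{}{n}{k} - \genfrac{[}{]}{0pt}{}{n-1}{k}.\]
   Context: $\genfrac{[}{]}{0pt}{}{n}{k} = \prod_{0 \leq i \leq k-1}\frac{q^{n-i}-1}{q^{k-i}-1}$. Two subspaces are disjoint if their intersection is the zero subspace. $[s+1] = \{1, \dots, s+1\}$. *)

theory Defs
  imports "Jordan_Normal_Form.VS_Connect" "HOL-Library.Cardinality"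
begin

text \<open>The \<open>k\<close>-dimensional subspaces of \<open>'a\<^sup>n\<close>, the space of vectors of length \<open>n\<close> over the
  field \<open>'a\<close>. Restricting the carrier to \<open>W\<close> turns the subspace \<open>W\<close> into a vector space of its
  own, whose dimension is then taken.\<close>

definition subspaces_of_dim :: "nat \<Rightarrow> nat \<Rightarrow> 'a :: field vec set set" where
  "subspaces_of_dim n k =
     {W. VectorSpace.subspace class_ring W (module_vec TYPE('a) n) \<and>
         vectorspace.dim class_ring ((module_vec TYPE('a) n)\<lparr>carrier := W\<rparr>) = k}"

definition disjoint_subspaces :: "nat \<Rightarrow> 'a :: field vec set \<Rightarrow> 'a vec set \<Rightarrow> bool" where
  "disjoint_subspaces n U W \<longleftrightarrow> U \<inter> W = {0\<^sub>v n}"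

text \<open>The exponent \<open>n - i\<close> is a truncated subtraction. For \<open>n < k\<close> the factor with \<open>i = n\<close>
  vanishes, so the product is \<open>0\<close> for \<open>n < k\<close>, as it is with integer exponents.\<close>

definition gauss_binomial :: "nat \<Rightarrow> nat \<Rightarrow> nat \<Rightarrow> real" where
  "gauss_binomial q n k = (\<Prod>i<k. (real q ^ (n - i) - 1) / (real q ^ (k - i) - 1))"

end

theory Submission
  imports Defs "Berlekamp_Zassenhaus.Berlekamp_Type_Based"
begin

text \<open>The bound is a positive fraction of all \<open>k\<close>-dimensional subspaces: the difference of the two
  Gaussian binomials grows like \<open>q\<^bsup>nk\<^esup>\<close>. On the other hand, a \<open>k\<close>-dimensional subspace through a
  fixed nonzero vector is spanned by it and \<open>k - 1\<close> further vectors, so there are at most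
  \<open>q\<^bsup>n(k - 1)\<^esup>\<close> of these, and at most \<open>q\<^bsup>k + n(k - 1)\<^esup>\<close> subspaces meet a given one. For large \<open>n\<close>,
  families exceeding the bound therefore contain pairwise disjoint members, chosen greedily.\<close>

section \<open>Vector spaces over a finite field\<close>

lemma (in vectorspace) fin_dim_if_finite_carrier:
  assumes "finite (carrier V)"
  shows fin_dim
proof -
  have "span (carrier V) = carrier V"
    using span_is_subset2[of "carrier V"] in_own_span[of "carrier V"] by blast
  then show ?thesis
    using assms unfolding fin_dim_def by blast
qed

text \<open>Every vector is determined by its coordinates in a finite basis, and a basis of
  \<open>dim\<close> elements has \<open>card (carrier K) ^ dim\<close> coordinate
  functions.\<close>

lemma (in vectorspace) card_carrier_le:
  assumes fd: fin_dim and K: "finite (carrier K)"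
  shows "card (carrier V) \<le> card (carrier K) ^ dim"
proof -
  obtain B where B: "finite B" "basis B"
    using finite_basis_exists[OF fd] by blast
  then have "B \<subseteq> carrier V"
    by (simp add: basis_def)
  then have "\<exists>a. a \<in> B \<rightarrow>\<^sub>E carrier K \<and> lincomb a B = v" if "v \<in> carrier V" for v
    using basis_criterion[OF B(1)] B(2) that by (blast dest: ex1_implies_ex)
  then have "carrier V \<subseteq> (\<lambda>a. lincomb a B) ` (B \<rightarrow>\<^sub>E carrier K)"
    by blast
  moreover have "finite (B \<rightarrow>\<^sub>E carrier K)"
    using B K by (simp add: finite_PiE)
  ultimately have "card (carrier V) \<le> card (B \<rightarrow>\<^sub>E carrier K)"
    by (meson surj_card_le)
  also have "\<dots> = card (carrier K) ^ dim"
    using B dim_basis by (simp add: card_PiE)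
  finally show ?thesis .
qed

text \<open>Steinitz exchange: \<open>v\<close> replaces one element of a basis. A list of exact
  length, rather than a set, makes the choices easy to count.\<close>

lemma (in vectorspace) gen_set_through_nonzero_vector:
  assumes fd: fin_dim and v: "v \<in> carrier V" "v \<noteq> \<zero>\<^bsub>V\<^esub>"
  obtains xs where "set xs \<subseteq> carrier V" "length xs = dim - 1" "gen_set (insert v (set xs))"
proof -
  obtain B where B: "finite B" "basis B"
    using finite_basis_exists[OF fd] by blast
  then have B': "B \<subseteq> carrier V" "span B = carrier V"
    by (auto simp: basis_def)
  \<comment> \<open>If \<open>{v}\<close> were dependent, \<open>v\<close> would lie in the span of
    the empty set, which is zero.\<close>
  have li: "lin_indpt {v}"
    using v lindep_span[of "{v}"] span_empty by auto
  obtain C where C: "finite C" "C \<subseteq> carrier V" "int (card C) \<le> int (card B) - int (card {v})"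
      "span ({v} \<union> C) = span B"
    using replacement[of "{v}" B] B(1) B' li v(1) by auto
  have le: "card C \<le> dim - 1"
    using C(3) dim_basis[OF B] by simp
  obtain ys where ys: "set ys = C" "length ys = card C"
    using C(1) by (metis finite_distinct_list distinct_card)
  show thesis
  proof
    \<comment> \<open>Exchange may return fewer than \<open>dim - 1\<close> vectors; padding with
      \<open>v\<close> fixes the length without changing the generating set.\<close>
    let ?xs = "ys @ replicate (dim - 1 - card C) v"
    show "set ?xs \<subseteq> carrier V"
      using C(2) v(1) ys by (auto simp: set_replicate_conv_if)
    show "length ?xs = dim - 1"
      using ys le by simp
    have "insert v (set ?xs) = {v} \<union> C"
      using ys by (auto simp: set_replicate_conv_if)
    then show "gen_set (insert v (set ?xs))"
      using C(4) B'(2) by simp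
  qed
qed

section \<open>Subspaces of a finite coordinate space and those through a fixed vector\<close>

lemma subspaces_of_dimD:
  fixes W :: "'a :: {field, finite} vec set"
  assumes "W \<in> subspaces_of_dim n k"
  shows "submodule class_ring W (module_vec TYPE('a) n)"
    and "vectorspace class_ring ((module_vec TYPE('a) n)\<lparr>carrier := W\<rparr>)"
    and "W \<subseteq> carrier_vec n"
    and "vectorspace.dim class_ring ((module_vec TYPE('a) n)\<lparr>carrier := W\<rparr>) = k"
    and "finite W"
proof -
  let ?V = "module_vec TYPE('a) n"
  interpret V: vectorspace class_ring ?V
    by (rule vec_vs)
  have sub: "VectorSpace.subspace class_ring W ?V"
    and "vectorspace.dim class_ring (?V\<lparr>carrier := W\<rparr>) = k"
    using assms by (simp_all add: subspaces_of_dim_def)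
  then show "submodule class_ring W ?V" "vectorspace class_ring (?V\<lparr>carrier := W\<rparr>)"
    "vectorspace.dim class_ring (?V\<lparr>carrier := W\<rparr>) = k"
    using V.subspace_is_vs by simp_all
  then show "W \<subseteq> carrier_vec n"
    using submodule.subset[of class_ring W ?V] by (simp add: module_vec_simps)
  then show "finite W"
    by (rule finite_subset) simp
qed

lemma zero_in_subspace:
  fixes W :: "'a :: {field, finite} vec set"
  assumes "W \<in> subspaces_of_dim n k"
  shows "0\<^sub>v n \<in> W"
proof -
  interpret W: vectorspace class_ring "(module_vec TYPE('a) n)\<lparr>carrier := W\<rparr>"
    using subspaces_of_dimD(2)[OF assms] .
  show ?thesis
    using W.zero_closed by (simp add: module_vec_simps)
qed

lemma card_subspace_le:
  fixes W :: "'a :: {field, finite} vec set"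
  assumes "W \<in> subspaces_of_dim n k"
  shows "card W \<le> CARD('a) ^ k"
proof -
  interpret W: vectorspace class_ring "(module_vec TYPE('a) n)\<lparr>carrier := W\<rparr>"
    using subspaces_of_dimD(2)[OF assms] .
  have "W.fin_dim"
    using W.fin_dim_if_finite_carrier subspaces_of_dimD(5)[OF assms] by simp
  from W.card_carrier_le[OF this] show ?thesis
    unfolding subspaces_of_dimD(4)[OF assms] by (simp add: class_ring_simps)
qed

lemma card_subspaces_through_vector_le:
  fixes v :: "'a :: {field, finite} vec"
  assumes v: "v \<noteq> 0\<^sub>v n"
  shows "card {W \<in> subspaces_of_dim n k. v \<in> W} \<le> CARD('a) ^ (n * (k - 1))"
proof -
  let ?V = "module_vec TYPE('a) n"
  let ?L = "{xs :: 'a vec list. set xs \<subseteq> carrier_vec n \<and> length xs = k - 1}"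
  interpret V: vectorspace class_ring ?V
    by (rule vec_vs)
  have "W \<in> (\<lambda>xs. V.span (insert v (set xs))) ` ?L" if W: "W \<in> subspaces_of_dim n k" "v \<in> W" for W
  proof -
    interpret W: vectorspace class_ring "?V\<lparr>carrier := W\<rparr>"
      using subspaces_of_dimD(2)[OF W(1)] .
    have "W.fin_dim"
      using W.fin_dim_if_finite_carrier subspaces_of_dimD(5)[OF W(1)] by simp
    then obtain xs where xs: "set xs \<subseteq> W" "length xs = k - 1" "W.span (insert v (set xs)) = W"
      using W.gen_set_through_nonzero_vector[of v] v W(2) subspaces_of_dimD(4)[OF W(1)]
      by (auto simp: module_vec_simps)
    \<comment> \<open>The span inside the submodule \<open>W\<close> agrees with the span in the
      whole space, so \<open>W\<close> can be recovered from \<open>xs\<close> alone.\<close>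
    then have "V.span (insert v (set xs)) = W"
      using V.span_li_not_depend(1)[OF _ subspaces_of_dimD(1)[OF W(1)]] W(2) by simp
    then show ?thesis
      using xs subspaces_of_dimD(3)[OF W(1)] by blast
  qed
  then have "{W \<in> subspaces_of_dim n k. v \<in> W} \<subseteq> (\<lambda>xs. V.span (insert v (set xs))) ` ?L"
    by blast
  moreover have "finite ?L"
    by (simp add: finite_lists_length_eq)
  ultimately have "card {W \<in> subspaces_of_dim n k. v \<in> W} \<le> card ?L"
    by (meson surj_card_le)
  also have "\<dots> = CARD('a) ^ (n * (k - 1))"
    by (simp add: card_lists_length_eq card_carrier_vec power_mult)
  finally show ?thesis .
qed

section \<open>Subspaces meeting a given one, and the greedy choice of disjoint ones\<close>

lemma finite_subspaces_of_dim: "finite (subspaces_of_dim n k :: 'a :: {field, finite} vec set set)"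
proof -
  have "subspaces_of_dim n k \<subseteq> Pow (carrier_vec n :: 'a vec set)"
    using subspaces_of_dimD(3) by blast
  then show ?thesis
    by (rule finite_subset) simp
qed

text \<open>All subspaces contain zero, so two that are not disjoint share a nonzero vector. The
  bound is a union bound over the fewer than \<open>CARD('a) ^ k\<close> nonzero vectors of
  \<open>U\<close>.\<close>

lemma card_subspaces_meeting_le:
  fixes U :: "'a :: {field, finite} vec set"
  assumes U: "U \<in> subspaces_of_dim n k"
  shows "card {W \<in> subspaces_of_dim n k. \<not> disjoint_subspaces n U W}
    \<le> CARD('a) ^ (k + n * (k - 1))"
proof -
  have "{W \<in> subspaces_of_dim n k. \<not> disjoint_subspaces n U W}
      \<subseteq> (\<Union>v\<in>U - {0\<^sub>v n}. {W \<in> subspaces_of_dim n k. v \<in> W})"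
    using zero_in_subspace[OF U] zero_in_subspace by (fastforce simp: disjoint_subspaces_def)
  then have "card {W \<in> subspaces_of_dim n k. \<not> disjoint_subspaces n U W}
      \<le> card (\<Union>v\<in>U - {0\<^sub>v n}. {W \<in> subspaces_of_dim n k. v \<in> W})"
    using subspaces_of_dimD(5)[OF U] finite_subspaces_of_dim[of n k, where 'a = 'a]
    by (intro card_mono) (auto intro: finite_subset)
  also have "\<dots> \<le> (\<Sum>v\<in>U - {0\<^sub>v n}. card {W \<in> subspaces_of_dim n k. v \<in> W})"
    using subspaces_of_dimD(5)[OF U] by (intro card_UN_le) auto
  also have "\<dots> \<le> card (U - {0\<^sub>v n}) * CARD('a) ^ (n * (k - 1))"
    using sum_mono[of "U - {0\<^sub>v n}" "\<lambda>v. card {W \<in> subspaces_of_dim n k. v \<in> W}"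
        "\<lambda>_. CARD('a) ^ (n * (k - 1))", OF card_subspaces_through_vector_le]
    by simp
  also have "\<dots> \<le> CARD('a) ^ k * CARD('a) ^ (n * (k - 1))"
    using card_subspace_le[OF U] card_Diff1_le[of U "0\<^sub>v n"] by (intro mult_right_mono) auto
  finally show ?thesis
    by (simp add: power_add)
qed

lemma rainbow_matching_if_large:
  fixes \<V> :: "nat \<Rightarrow> 'a :: {field, finite} vec set set"
  assumes sub: "\<And>i. i \<in> {1..m} \<Longrightarrow> \<V> i \<subseteq> subspaces_of_dim n k"
    and large: "\<And>i. i \<in> {1..m} \<Longrightarrow> (m - 1) * CARD('a) ^ (k + n * (k - 1)) < card (\<V> i)"
  shows "\<exists>V. (\<forall>i\<in>{1..m}. V i \<in> \<V> i) \<and>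
    pairwise (\<lambda>i j. disjoint_subspaces n (V i) (V j)) {1..m}"
proof -
  \<comment> \<open>Greedy choice by induction on \<open>l\<close> with \<open>m\<close> fixed, so
    that the size hypothesis, stated in terms of \<open>m\<close>, serves every step.\<close>
  have "\<exists>V. (\<forall>i\<in>{1..l}. V i \<in> \<V> i) \<and> pairwise (\<lambda>i j. disjoint_subspaces n (V i) (V j)) {1..l}"
    if "l \<le> m" for l
    using that
  proof (induction l)
    case (Suc l)
    then obtain V where V: "\<forall>i\<in>{1..l}. V i \<in> \<V> i"
        "pairwise (\<lambda>i j. disjoint_subspaces n (V i) (V j)) {1..l}"
      using Suc_leD by blast
    let ?bad = "\<Union>i\<in>{1..l}. {W \<in> subspaces_of_dim n k. \<not> disjoint_subspaces n (V i) W}"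
    have "card ?bad \<le> (\<Sum>i=1..l. card {W \<in> subspaces_of_dim n k. \<not> disjoint_subspaces n (V i) W})"
      by (intro card_UN_le) auto
    also have "\<dots> \<le> (\<Sum>i=1..l. CARD('a) ^ (k + n * (k - 1)))"
      using V(1) sub Suc.prems by (intro sum_mono card_subspaces_meeting_le) force
    \<comment> \<open>Before choice number \<open>Suc l\<close> only \<open>l\<close> \<le>
      \<open>m - 1\<close> subspaces have been fixed.\<close>
    also have "\<dots> \<le> (m - 1) * CARD('a) ^ (k + n * (k - 1))"
      using Suc.prems by simp
    also have "\<dots> < card (\<V> (Suc l))"
      using large Suc.prems by simp
    finally have "\<not> \<V> (Suc l) \<subseteq> ?bad"
      using card_mono[of ?bad "\<V> (Suc l)"] finite_subspaces_of_dim by fastforce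
    then obtain W where W: "W \<in> \<V> (Suc l)" "W \<notin> ?bad"
      by blast
    moreover have "W \<in> subspaces_of_dim n k"
      using W(1) sub Suc.prems by auto
    ultimately have disj: "disjoint_subspaces n (V i) W" if "i \<in> {1..l}" for i
      using that by blast
    let ?V = "V(Suc l := W)"
    have "\<forall>i\<in>{1..Suc l}. ?V i \<in> \<V> i"
      using V(1) W(1) by (auto simp: le_Suc_eq)
    moreover have "pairwise (\<lambda>i j. disjoint_subspaces n (?V i) (?V j)) {1..Suc l}"
    proof (rule pairwiseI)
      fix i j assume ij: "i \<in> {1..Suc l}" "j \<in> {1..Suc l}" "i \<noteq> j"
      have old: "x \<in> {1..l}" if "x \<in> {1..Suc l}" "x \<noteq> Suc l" for x
        using that by auto
      show "disjoint_subspaces n (?V i) (?V j)"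
      \<comment> \<open>Either index may be the new one; disjointness is symmetric.\<close>
      proof (cases "i = Suc l \<or> j = Suc l")
        case True
        then show ?thesis
          using disj[OF old[OF ij(1)]] disj[OF old[OF ij(2)]] ij(3)
          by (auto simp: disjoint_subspaces_def Int_commute)
      next
        case False
        then show ?thesis
          using pairwiseD[OF V(2) old[OF ij(1)] old[OF ij(2)] ij(3)] by simp
      qed
    qed
    ultimately show ?case
      by blast
  qed auto
  then show ?thesis
    by blast
qed

section \<open>Lower bounds for the difference of Gaussian binomials\<close>

lemma power_pred_le_power_minus_one:
  fixes q :: real
  assumes "q \<ge> 2" "m \<ge> 1"
  shows "q ^ (m - 1) \<le> q ^ m - 1"
proof -
  have "2 * q ^ (m - 1) \<le> q * q ^ (m - 1)"
    using assms by (intro mult_right_mono) auto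
  moreover have "q * q ^ (m - 1) = q ^ m"
    using assms by (simp add: power_eq_if)
  moreover have "1 \<le> q ^ (m - 1)"
    using assms by simp
  ultimately show ?thesis
    by linarith
qed

text \<open>Over the common denominator the two numerators share \<open>k - 1\<close> factors; only
  the first factor \<open>q^n - 1\<close> of one and the last factor \<open>q^(n-k) - 1\<close> of
  the other differ.\<close>

lemma gauss_binomial_diff:
  assumes "k \<ge> 1" "n > k"
  shows "gauss_binomial q n k - gauss_binomial q (n - 1) k =
    (real q ^ n - real q ^ (n - k)) * (\<Prod>i<k-1. real q ^ (n - 1 - i) - 1) / (\<Prod>i<k. real q ^ (k - i) - 1)"
proof -
  obtain j where k: "k = Suc j"
    using assms by (cases k) auto
  have "(\<Prod>i<k. real q ^ (n - i) - 1) = (real q ^ n - 1) * (\<Prod>i<j. real q ^ (n - 1 - i) - 1)"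
    unfolding k prod.lessThan_Suc_shift by simp
  moreover have "(\<Prod>i<k. real q ^ (n - 1 - i) - 1)
      = (real q ^ (n - k) - 1) * (\<Prod>i<j. real q ^ (n - 1 - i) - 1)"
    unfolding k by simp
  ultimately show ?thesis
    unfolding gauss_binomial_def prod_dividef using k
    by (simp add: diff_divide_distrib[symmetric] algebra_simps)
qed

text \<open>In the closed form, \<open>q^n - q^(n-k)\<close> is at least \<open>q^(n-1)\<close>,
  each of the \<open>k - 1\<close> remaining numerator factors is at least \<open>q^(n-k)\<close>,
  and the denominator is at most \<open>q^(k*k)\<close>.\<close>

lemma gauss_binomial_diff_ge:
  assumes q: "q \<ge> 2" and k: "k \<ge> 1" and n: "n > k"
  shows "real q ^ (n - 1 + (n - k) * (k - 1))
    \<le> real q ^ (k * k) * (gauss_binomial q n k - gauss_binomial q (n - 1) k)"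
proof -
  let ?D = "\<Prod>i<k. real q ^ (k - i) - 1"
  have D: "?D \<le> real q ^ (k * k)" "?D > 0"
  proof -
    have "?D \<le> (\<Prod>i<k. real q ^ k)"
    proof (intro prod_mono conjI)
      fix i assume "i \<in> {..<k}"
      show "0 \<le> real q ^ (k - i) - 1"
        using q by simp
      have "real q ^ (k - i) \<le> real q ^ k"
        using q by (intro power_increasing) auto
      then show "real q ^ (k - i) - 1 \<le> real q ^ k"
        by simp
    qed
    then show "?D \<le> real q ^ (k * k)"
      by (simp add: power_mult)
    show "?D > 0"
      using q by (intro prod_pos) auto
  qed
  have P: "real q ^ ((n - k) * (k - 1)) \<le> (\<Prod>i<k-1. real q ^ (n - 1 - i) - 1)"
  proof -
    have "(\<Prod>i<k-1. real q ^ (n - k)) \<le> (\<Prod>i<k-1. real q ^ (n - 1 - i) - 1)"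
    proof (intro prod_mono conjI)
      fix i assume i: "i \<in> {..<k-1}"
      \<comment> \<open>From \<open>i\<close> \<le> \<open>k - 2\<close> the exponent can drop by
        one more and stay at least \<open>n - k\<close>; that drop pays for the \<open>- 1\<close>
        in the factor.\<close>
      have "real q ^ (n - k) \<le> real q ^ (n - 1 - i - 1)"
        using q i n by (intro power_increasing) auto
      also have "\<dots> \<le> real q ^ (n - 1 - i) - 1"
        using q i n by (intro power_pred_le_power_minus_one) auto
      finally show "real q ^ (n - k) \<le> real q ^ (n - 1 - i) - 1" .
    qed simp
    then show ?thesis
      by (simp add: power_mult)
  qed
  have "real q ^ (n - k) \<le> real q ^ (n - 1)"
    using q k by (intro power_increasing) auto
  moreover have "2 * real q ^ (n - 1) \<le> real q * real q ^ (n - 1)"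
    using q by (intro mult_right_mono) auto
  moreover have "real q * real q ^ (n - 1) = real q ^ n"
    using n by (simp add: power_eq_if)
  ultimately have A: "real q ^ (n - 1) \<le> real q ^ n - real q ^ (n - k)"
    by linarith
  let ?G = "gauss_binomial q n k - gauss_binomial q (n - 1) k"
  have "real q ^ (n - 1 + (n - k) * (k - 1))
      \<le> (real q ^ n - real q ^ (n - k)) * (\<Prod>i<k-1. real q ^ (n - 1 - i) - 1)"
    unfolding power_add using A P
    by (intro mult_mono) (use A in \<open>auto intro: order_trans[rotated] simp del: diff_ge_0_iff_ge\<close>)
  also have eq: "\<dots> = ?D * ?G"
    by (simp only: gauss_binomial_diff[OF k n] times_divide_eq_right
        nonzero_mult_div_cancel_left[OF less_imp_neq[OF D(2), symmetric]])
  finally have le: "real q ^ (n - 1 + (n - k) * (k - 1)) \<le> ?D * ?G" .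
  \<comment> \<open>Enlarging \<open>?D\<close> to \<open>q^(k*k)\<close> requires \<open>?G\<close>
    to be nonnegative, which follows from \<open>le\<close> because \<open>?D\<close> is
    positive.\<close>
  have "0 \<le> real q ^ (n - 1 + (n - k) * (k - 1))"
    by simp
  also note le
  finally have "?G \<ge> 0"
    using D(2) zero_le_mult_iff[of ?D ?G] by linarith
  then have "?D * ?G \<le> real q ^ (k * k) * ?G"
    using D(1) by (intro mult_right_mono)
  with le show ?thesis
    by linarith
qed

text \<open>The factor \<open>s\<close> is absorbed by \<open>s < q^s\<close>, which also gives
  strictness. Comparing exponents then asks for \<open>s + k*k + k + k*(k-1)\<close> \<le>
  \<open>n - 1\<close>; the left side is \<open>s + 2*k*k\<close>, whence the threshold on
  \<open>n\<close>.\<close>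

lemma gauss_binomial_diff_gt:
  assumes q: "q \<ge> 2" and k: "k \<ge> 1" and n: "n \<ge> 2 * (k * k) + 1 + s"
  shows "real (s * q ^ (k + n * (k - 1))) < gauss_binomial q n k - gauss_binomial q (n - 1) k"
proof -
  have nk: "n > k"
    using n le_square[of k] by linarith
  have "s < 2 ^ s"
    by (rule less_exp)
  also have "\<dots> \<le> q ^ s"
    using q by (intro power_mono) auto
  finally have "s * q ^ (k * k + k + n * (k - 1)) < q ^ s * q ^ (k * k + k + n * (k - 1))"
    using q by (intro mult_strict_right_mono) auto
  also have "\<dots> = q ^ (s + k * k + k + n * (k - 1))"
    by (simp add: power_add mult_ac)
  also have "\<dots> \<le> q ^ (n - 1 + (n - k) * (k - 1))"
  proof (intro power_increasing)
    obtain j where j: "k = Suc j"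
      using k by (cases k) auto
    obtain d where d: "n = d + 2 * (k * k) + 1 + s"
      using n by (metis le_add_diff_inverse2 add.assoc)
    \<comment> \<open>Together with \<open>k * (k - 1)\<close> \<le> \<open>n * (k - 1)\<close>,
      this makes the truncated subtraction exact and leaves a linear comparison.\<close>
    have "(n - k) * (k - 1) = n * (k - 1) - k * (k - 1)"
      by (simp add: diff_mult_distrib)
    moreover have "k * (k - 1) \<le> n * (k - 1)"
      using nk by simp
    moreover have "s + k * k + k + k * (k - 1) \<le> n - 1"
      using d j by (simp add: algebra_simps)
    ultimately show "s + k * k + k + n * (k - 1) \<le> n - 1 + (n - k) * (k - 1)"
      by linarith
  qed (use q in auto)
  finally have "real (s * q ^ (k * k + k + n * (k - 1))) < real q ^ (n - 1 + (n - k) * (k - 1))"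
    by (metis of_nat_less_iff of_nat_power)
  also have "\<dots> \<le> real q ^ (k * k) * (gauss_binomial q n k - gauss_binomial q (n - 1) k)"
    by (rule gauss_binomial_diff_ge[OF q k nk])
  finally have "real q ^ (k * k) * real (s * q ^ (k + n * (k - 1)))
      < real q ^ (k * k) * (gauss_binomial q n k - gauss_binomial q (n - 1) k)"
    by (simp add: power_add mult_ac)
  then show ?thesis
    using q by (simp add: mult_less_cancel_left_pos)
qed

text \<open>Prime powers are exactly the sizes of finite fields, so \<open>q\<close> is given as the
  cardinality of a finite field type.\<close>

theorem theorem4p11:
  fixes q k s :: nat
  assumes q: "q = CARD('a :: {field, finite})"
    and k: "k \<ge> 1" and s: "s \<ge> 1"
  shows "\<exists>N. \<forall>n\<ge>N. \<forall>\<V> :: nat \<Rightarrow> 'a vec set set.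
           (\<forall>i\<in>{1..s+1}. \<V> i \<subseteq> subspaces_of_dim n k) \<longrightarrow>
           \<not> (\<exists>V :: nat \<Rightarrow> 'a vec set.
                 (\<forall>i\<in>{1..s+1}. V i \<in> \<V> i) \<and>
                 pairwise (\<lambda>i j. disjoint_subspaces n (V i) (V j)) {1..s+1}) \<longrightarrow>
           real (MIN i\<in>{1..s+1}. card (\<V> i))
             \<le> gauss_binomial q n k - gauss_binomial q (n - 1) k"
proof (intro exI[of _ "2 * (k * k) + 1 + s"] allI impI)
  fix n and \<V> :: "nat \<Rightarrow> 'a vec set set"
  assume n: "n \<ge> 2 * (k * k) + 1 + s"
    and sub: "\<forall>i\<in>{1..s+1}. \<V> i \<subseteq> subspaces_of_dim n k"
    and no: "\<not> (\<exists>V :: nat \<Rightarrow> 'a vec set. (\<forall>i\<in>{1..s+1}. V i \<in> \<V> i) \<and>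
      pairwise (\<lambda>i j. disjoint_subspaces n (V i) (V j)) {1..s+1})"
  have "card {0, 1 :: 'a} \<le> CARD('a)"
    by (intro card_mono) auto
  then have q2: "q \<ge> 2"
    by (simp add: q)
  \<comment> \<open>Contrapositive of the greedy choice with \<open>m = s + 1\<close>, so that
    \<open>m - 1\<close> becomes \<open>s\<close>.\<close>
  have "\<exists>i\<in>{1..s+1}. card (\<V> i) \<le> s * q ^ (k + n * (k - 1))"
    using rainbow_matching_if_large[of "s + 1" \<V> n k] sub no unfolding q
    by (metis add_diff_cancel_right' not_le)
  then obtain i where i: "i \<in> {1..s+1}" "card (\<V> i) \<le> s * q ^ (k + n * (k - 1))"
    by blast
  have "(MIN i\<in>{1..s+1}. card (\<V> i)) \<le> card (\<V> i)"
    using i(1) by (intro Min_le) auto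
  with i(2) have "real (MIN i\<in>{1..s+1}. card (\<V> i)) \<le> real (s * q ^ (k + n * (k - 1)))"
    by (meson of_nat_mono order_trans)
  also have "\<dots> \<le> gauss_binomial q n k - gauss_binomial q (n - 1) k"
    using gauss_binomial_diff_gt[OF q2 k n] by (rule less_imp_le)
  finally show "real (MIN i\<in>{1..s+1}. card (\<V> i))
      \<le> gauss_binomial q n k - gauss_binomial q (n - 1) k" .
qed

end
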